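(* In the setting described in the context (smooth and convex objectives $f_1,\dots,f_m$, bounded closed convex feasible region $\mathcal{X}$, bounds on the moments of the stochastic gradients, Lipschitz continuity of the subproblem solution), let $x_*$ be any point in $\mathcal{X}$ and let the step sizes be $\alpha_k=\frac{\bar\alpha}{\sqrt k}$, $k\ge1$, where $\bar\alpha$ is any positive constant. Then the sequence of iterates generated by the Stochastic Multi-Gradient algorithm satisfies, for every $k\ge1$, $$\min_{s=1,\ldots,k}\mathbb{E}[S(x_s,\lambda_s)]-\mathbb{E}[S(x_*,\bar\lambda_k)]\;\le\;\frac{\frac{\Theta^2}{2\bar\alpha}+\bar\alpha\,\big(L_g^2+2\Theta(L_{\nabla S}+\beta L_{\nabla S}M_S)\big)}{\sqrt k},$$ where $\bar\lambda_k=\frac1k\sum_{s=1}^k\lambda_s\in\Delta^m$.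
   Context: **Problem.** Let $m\ge 2$, let $\mathcal{X}\subset\mathbb{R}^n$ be nonempty, closed and convex, let $w$ be a random variable whose distribution does not depend on $x$, and let $f_i:\mathbb{R}^n\to\mathbb{R}$, $f_i(x)=\mathbb{E}[f_i(x,w)]$, $i=1,\dots,m$. The stochastic multi-objective problem is to minimize $F(x)=(f_1(x),\dots,f_m(x))^\top$ over $x\in\mathcal{X}$. Norms are Euclidean. Let $\Delta^m=\{\lambda\in\mathbb{R}^m:\sum_{i=1}^m\lambda_i=1,\ \lambda_i\ge 0\ \forall i\}$ and $S(x,\lambda)=\sum_{i=1}^m\lambda_i f_i(x)$, so $\nabla_xS(x,\lambda)=\sum_{i=1}^m\lambda_i\nabla f_i(x)$. **Algorithm (Stochastic Multi-Gradient, SMG).** Let $\{w_k\}$ be independent copies of $w$ and $\{\alpha_k\}$ positive step sizes. Start from a point $x_1\in\mathcal{X}$. For $k=1,2,\dots$: compute stochastic gradients $g_i(x_k,w_k)\in\mathbb{R}^n$, $i=1,\dots,m$; compute $\lambda^g_k\in\operatorname{argmin}_{\lambda\in\Delta^m}\|\sum_{i=1}^m\lambda_i g_i(x_k,w_k)\|^2$; set $g(x_k,w_k)=\sum_{i=1}^m(\lambda^g_k)_i\,g_i(x_k,w_k)$; set $x_{k+1}=P_{\mathcal{X}}(x_k-\alpha_k g(x_k,w_k))$, where $P_{\mathcal{X}}$ is the orthogonal projection onto $\mathcal{X}$. In addition, $\lambda_k$ denotes the solution in the corresponding subproblem with true gradients: $\lambda_k\in\operatorname{argmin}_{\lambda\in\Delta^m}\|\sum_{i=1}^m\lambda_i\nabla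 f_i(x_k)\|^2$. $\mathbb{E}_{w_k}[\cdot]$ is the expectation with respect to $w_k$ ($x_k$ does not depend on $w_k$ and is held fixed), $\mathbb{V}_{w_k}[Y]=\mathbb{E}_{w_k}[\|Y\|^2]-\|\mathbb{E}_{w_k}[Y]\|^2$, and $\mathbb{E}[\cdot]$ is the expectation with respect to the joint distribution of $\{w_k\}$. **Assumptions.** 1. (Lipschitz gradients) Each $f_i$ is continuously differentiable and $\|\nabla f_i(x)-\nabla f_i(\bar x)\|\le L_i\|x-\bar x\|$ for all $x,\bar x\in\mathbb{R}^n$, with $L_i>0$. Put $L=\max_iL_i$. 2. (Stochastic gradients) For all $i$ and all iterates $k$: (a) $\mathbb{E}_{w_k}[g_i(x_k,w_k)]=\nabla f_i(x_k)$; (b) there are constants $C_i,\hat C_i>0$ (independent of $k$) with $\mathbb{E}_{w_k}[\|g_i(x_k,w_k)-\nabla f_i(x_k)\|]\le\alpha_k(C_i+\hat C_i\|\nabla f_i(x_k)\|)$; (c) there are constants $G_i,\hat G_i>0$ (independent of $k$) with $\mathbb{V}_{w_k}[g_i(x_k,w_k)]\le G_i^2+\hat G_i^2\|\nabla f_i(x_k)\|^2$. 3. (Bounded feasible region) $\mathcal{X}$ is bounded; $\Theta>0$ is a finite constant with $\max_{x,y\in\mathcal{X}}\|x-y\|\le\Theta$. 4. (Subproblem Lipschitz continuity) The optimal solution of $\min_{\lambda\in\Delta^m}\|\sum_i\lambda_iv_i\|^2$ is a Lipschitz function $\lambda(v_1,\dots,v_m)$ of the parameters, on the set of parameter tuples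 that arise (the tuples $(\nabla f_1(x),\dots,\nabla f_m(x))$, $x\in\mathcal{X}$, and the tuples of stochastic gradients $(g_1(x_k,w_k),\dots,g_m(x_k,w_k))$): there is $\beta>0$ with $\|\lambda(v_1,\dots,v_m)-\lambda(v_1',\dots,v_m')\|\le\beta\,\|[(v_1-v_1')^\top,\dots,(v_m-v_m')^\top]\|$ for all such tuples. Here $\lambda_k=\lambda(\nabla f_1(x_k),\dots,\nabla f_m(x_k))$ and $\lambda_k^g=\lambda(g_1(x_k,w_k),\dots,g_m(x_k,w_k))$. 5. (Convexity) Every $f_i:\mathbb{R}^n\to\mathbb{R}$ is convex, and the convex function $S(\cdot,\lambda)$ attains a minimizer for any $\lambda\in\Delta^m$. **Constants.** $M_\nabla$ is the largest of the norms $\|\nabla f_i\|$, $i=1,\dots,m$, at an arbitrary fixed point of $\mathcal{X}$; $M_1=\sum_{i=1}^mC_i$; $M_F=\max_i\hat C_i$; $G^2=m\sum_{i=1}^mG_i^2$; $G_V^2=m\max_i(\hat G_i^2+1)$; $L_{\nabla S}=M_1+mM_F(M_\nabla+L\Theta)$; $L_g^2=G^2+mG_V^2(M_\nabla+L\Theta)^2$; $M_S=\sqrt{mn}\,(M_\nabla+L\Theta)$. *)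

theory Defs
  imports "HOL-Probability.Probability"
begin

definition prob_simplex :: "(real ^ 'm::finite) set" where
  "prob_simplex = {l. (\<Sum>i\<in>UNIV. l $ i) = 1 \<and> (\<forall>i. 0 \<le> l $ i)}"

definition weighted_sum :: "('m::finite \<Rightarrow> real ^ 'n \<Rightarrow> real) \<Rightarrow> real ^ 'n \<Rightarrow> real ^ 'm \<Rightarrow> real" where
  "weighted_sum f x l = (\<Sum>i\<in>UNIV. l $ i * f i x)"

definition combine :: "real ^ 'm \<Rightarrow> (real ^ 'n) ^ 'm::finite \<Rightarrow> real ^ 'n::finite" where
  "combine l v = (\<Sum>i\<in>UNIV. l $ i *\<^sub>R v $ i)"

text \<open>A tuple of \<open>m\<close> vectors in \<open>n\<close>-space is an element of \<^typ>\<open>(real ^ 'n) ^ 'm\<close>; the norm of that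
  type is the Euclidean norm of the concatenated vector.\<close>

definition min_norm_weights :: "(real ^ 'n::finite) ^ 'm::finite \<Rightarrow> (real ^ 'm) set" where
  "min_norm_weights v =
     {l. is_arg_min (\<lambda>l. (norm (combine l v))\<^sup>2) (\<lambda>l. l \<in> prob_simplex) l}"

definition vec_variance :: "'w measure \<Rightarrow> ('w \<Rightarrow> real ^ 'n::finite) \<Rightarrow> real" where
  "vec_variance D Y = (\<integral>\<xi>. (norm (Y \<xi>))\<^sup>2 \<partial>D) - (norm (\<integral>\<xi>. Y \<xi> \<partial>D))\<^sup>2"

text \<open>The processes \<open>x\<close> and \<open>lg\<close> are a run of the stochastic multi-gradient algorithm, driven by
  the samples \<open>w\<close> and started at the deterministic point \<open>x1\<close>. Iterations are numbered from 1;
  the values at index 0 are unconstrained.\<close>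

definition smg_run ::
  "'a measure \<Rightarrow> (real ^ 'n) set \<Rightarrow> (nat \<Rightarrow> real)
   \<Rightarrow> ('m::finite \<Rightarrow> real ^ 'n \<Rightarrow> 'w \<Rightarrow> real ^ 'n::finite) \<Rightarrow> (nat \<Rightarrow> 'a \<Rightarrow> 'w)
   \<Rightarrow> real ^ 'n \<Rightarrow> (nat \<Rightarrow> 'a \<Rightarrow> real ^ 'n) \<Rightarrow> (nat \<Rightarrow> 'a \<Rightarrow> real ^ 'm) \<Rightarrow> bool" where
  "smg_run M X \<alpha> g w x1 x lg \<longleftrightarrow>
     x1 \<in> X \<and>
     (\<forall>\<omega>\<in>space M. x 1 \<omega> = x1 \<and>
        (\<forall>k\<ge>1. lg k \<omega> \<in> min_norm_weights (\<chi> i. g i (x k \<omega>) (w k \<omega>)) \<and>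
           x (Suc k) \<omega> =
             closest_point X (x k \<omega> - \<alpha> k *\<^sub>R combine (lg k \<omega>) (\<chi> i. g i (x k \<omega>) (w k \<omega>)))))"

text \<open>The parameter tuples on which the subproblem solution is required to be Lipschitz: the true
  gradients over \<open>X\<close>, and the stochastic gradients occurring along the run.\<close>

definition arising_tuples ::
  "'a measure \<Rightarrow> (real ^ 'n) set \<Rightarrow> ('m::finite \<Rightarrow> real ^ 'n \<Rightarrow> real ^ 'n)
   \<Rightarrow> ('m \<Rightarrow> real ^ 'n \<Rightarrow> 'w \<Rightarrow> real ^ 'n::finite) \<Rightarrow> (nat \<Rightarrow> 'a \<Rightarrow> 'w)
   \<Rightarrow> (nat \<Rightarrow> 'a \<Rightarrow> real ^ 'n) \<Rightarrow> ((real ^ 'n) ^ 'm) set" where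
  "arising_tuples M X df g w x =
     {\<chi> i. df i y | y. y \<in> X} \<union>
     {\<chi> i. g i (x k \<omega>) (w k \<omega>) | k \<omega>. 1 \<le> k \<and> \<omega> \<in> space M}"

end

theory Submission
  imports Defs
begin

text \<open>
  Nonexpansiveness of the projection gives the projected (sub)gradient inequality for the distance
  to \<open>xstar\<close>. Convexity of \<open>S(\<cdot>, \<lambda>\<^sub>k)\<close> is used at the weights \<open>\<lambda>\<^sub>k\<close> of the true gradients, and the
  gap to the step actually taken is split in two: the error of the stochastic gradients at the
  weights \<open>\<lambda>\<^sub>k\<^sup>g\<close>, and the change of weights, which the Lipschitz property of the subproblem
  solution again bounds by the error of the stochastic gradients. All terms are thus controlled by
  first and second moments of norms, which are computed by Fubini because \<open>x\<^sub>k\<close> is a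
  measurable function of \<open>w\<^sub>1, \<dots>, w\<^sub>k\<^sub>-\<^sub>1\<close> and hence independent of \<open>w\<^sub>k\<close>. With steps of order
  \<open>1/sqrt k\<close> the resulting recursion telescopes after division by \<open>\<alpha>\<^sub>k\<close>.
\<close>

section \<open>Tangent inequality for convex functions, and the scalar recursion behind the
  rate\<close>

text \<open>Restricting \<open>f\<close> to the line through \<open>y\<close> and \<open>z\<close>
  reduces this to the one-dimensional tangent inequality at parameter 0, evaluated at parameter
  1.\<close>

lemma convex_on_above_gradient:
  fixes f :: "'a::real_inner \<Rightarrow> real"
  assumes "convex_on UNIV f" and "GDERIV f y :> v"
  shows "f y + v \<bullet> (z - y) \<le> f z"
proof -
  define h where "h t = f (y + t *\<^sub>R (z - y))" for t :: real
  have "convex_on UNIV h"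
  proof (rule convex_onI)
    fix t a b :: real
    assume t: "0 < t" "t < 1"
    have "y + ((1 - t) *\<^sub>R a + t *\<^sub>R b) *\<^sub>R (z - y)
        = (1 - t) *\<^sub>R (y + a *\<^sub>R (z - y)) + t *\<^sub>R (y + b *\<^sub>R (z - y))"
      by (simp add: algebra_simps)
    then show "h ((1 - t) *\<^sub>R a + t *\<^sub>R b) \<le> (1 - t) * h a + t * h b"
      unfolding h_def using convex_onD[OF assms(1)] t by simp
  qed auto
  moreover have "(h has_real_derivative v \<bullet> (z - y)) (at 0)"
  proof -
    have "(f has_derivative (\<lambda>h. h \<bullet> v)) (at (y + 0 *\<^sub>R (z - y)))"
      using assms(2) by (simp add: gderiv_def)
    moreover have "((\<lambda>t. y + t *\<^sub>R (z - y)) has_derivative (\<lambda>t. t *\<^sub>R (z - y))) (at 0)"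
      by (auto intro!: derivative_eq_intros)
    ultimately have "(h has_derivative (\<lambda>t. (t *\<^sub>R (z - y)) \<bullet> v)) (at 0)"
      unfolding h_def by (rule has_derivative_compose[rotated])
    then show ?thesis
      by (simp add: has_field_derivative_def inner_commute mult_commute_abs)
  qed
  ultimately have "h 1 - h 0 \<ge> (v \<bullet> (z - y)) * (1 - 0)"
    by (intro convex_on_imp_above_tangent[where A = UNIV]) auto
  then show ?thesis by (simp add: h_def)
qed

text \<open>Dividing by \<open>2 * \<gamma> / sqrt s\<close> puts the growing weight
  \<open>sqrt s / (2 * \<gamma>)\<close> on \<open>a s - a (Suc s)\<close>. The growth of the
  weights is paid for by the bound \<open>T\<close>, and the terms with \<open>c\<close> sum to at
  most \<open>\<gamma> * c * sqrt k\<close>.\<close>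

lemma sum_le_sqrt_of_decrease:
  fixes a e :: "nat \<Rightarrow> real"
  assumes "\<gamma> > 0" "c \<ge> 0"
    and a: "\<And>s. s \<ge> 1 \<Longrightarrow> 0 \<le> a s" "\<And>s. s \<ge> 1 \<Longrightarrow> a s \<le> T"
    and decrease: "\<And>s. s \<ge> 1 \<Longrightarrow>
      a (Suc s) + 2 * (\<gamma> / sqrt s) * e s \<le> a s + (\<gamma> / sqrt s)\<^sup>2 * c"
  shows "(\<Sum>s=1..k. e s) \<le> (T / (2 * \<gamma>) + \<gamma> * c) * sqrt k"
proof -
  \<comment> \<open>The induction keeps the leftover term of the telescoping sum on the left; its
    sign allows dropping it only at the end.\<close>
  have "(\<Sum>s=1..k. e s) + a (Suc k) * sqrt k / (2 * \<gamma>) \<le> (T / (2 * \<gamma>) + \<gamma> * c) * sqrt k" for k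
  proof (induction k)
    case 0
    then show ?case by simp
  next
    case (Suc k)
    define q r where "q = sqrt (Suc k)" and "r = sqrt k"
    have q: "q > 0" "r \<ge> 0" "r \<le> q" "q * q = r * r + 1"
      by (auto simp: q_def r_def)
    \<comment> \<open>This is \<open>1 / (2 * sqrt (Suc k)) \<le> sqrt (Suc k) - sqrt k\<close>,
      which makes the terms with \<open>c\<close> telescope as well.\<close>
    have "q * (2 * (q - r)) \<ge> 1"
    proof -
      have "q * (2 * (q - r)) = (q - r)\<^sup>2 + 1"
        using q(4) by (simp add: power2_eq_square algebra_simps)
      then show ?thesis by simp
    qed
    then have inv: "1 / (2 * q) \<le> q - r"
      using q(1) by (simp add: field_simps)
    have "e (Suc k) = (2 * (\<gamma> / q) * e (Suc k)) * (q / (2 * \<gamma>))"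
      using q(1) assms(1) by simp
    also have "\<dots> \<le> (a (Suc k) - a (Suc (Suc k)) + (\<gamma> / q)\<^sup>2 * c) * (q / (2 * \<gamma>))"
      using decrease[of "Suc k"] q(1) assms(1) by (intro mult_right_mono) (auto simp: q_def)
    also have "\<dots> = (a (Suc k) - a (Suc (Suc k))) * q / (2 * \<gamma>) + \<gamma> * c * (1 / (2 * q))"
      using q(1) assms(1) by (simp add: field_simps power2_eq_square)
    also have "\<dots> \<le> (a (Suc k) - a (Suc (Suc k))) * q / (2 * \<gamma>) + \<gamma> * c * (q - r)"
      using inv assms by (intro add_left_mono mult_left_mono) auto
    finally have "e (Suc k) \<le> (a (Suc k) - a (Suc (Suc k))) * q / (2 * \<gamma>) + \<gamma> * c * (q - r)" .
    \<comment> \<open>The weight on \<open>a (Suc k)\<close> rises from \<open>r\<close> to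
      \<open>q\<close>; the upper bound \<open>T\<close> is spent on this increment.\<close>
    moreover have "a (Suc k) * (q - r) / (2 * \<gamma>) \<le> T * (q - r) / (2 * \<gamma>)"
      using q a(2)[of "Suc k"] assms(1) by (intro divide_right_mono mult_right_mono) auto
    ultimately show ?case
      using Suc.IH unfolding q_def[symmetric] r_def[symmetric]
      by (simp add: algebra_simps diff_divide_distrib add_divide_distrib)
  qed
  from this[of k] have "(\<Sum>s=1..k. e s) + a (Suc k) * sqrt k / (2 * \<gamma>)
      \<le> (T / (2 * \<gamma>) + \<gamma> * c) * sqrt k" .
  moreover have "0 \<le> a (Suc k) * sqrt k / (2 * \<gamma>)"
    using a(1)[of "Suc k"] assms(1) by simp
  ultimately show ?thesis by linarith
qed

section \<open>Weighted combinations of vectors\<close>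

lemma combine_diff: "combine (l - l') v = combine l v - combine l' v"
  by (simp add: combine_def scaleR_left_diff_distrib sum_subtractf)

lemma combine_diff_right: "combine l (u - v) = combine l u - combine l v"
  by (simp add: combine_def scaleR_right_diff_distrib sum_subtractf)

lemma prob_simplex_bounds:
  assumes "l \<in> prob_simplex"
  shows "0 \<le> l $ i" "l $ i \<le> 1"
proof -
  show "0 \<le> l $ i" using assms by (simp add: prob_simplex_def)
  have "l $ i \<le> (\<Sum>j\<in>UNIV. l $ j)"
    using assms by (intro member_le_sum) (auto simp: prob_simplex_def)
  then show "l $ i \<le> 1" using assms by (simp add: prob_simplex_def)
qed

lemma norm_combine_le_sum:
  assumes "l \<in> prob_simplex"
  shows "norm (combine l u) \<le> (\<Sum>i\<in>UNIV. norm (u $ i))"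
proof -
  have "norm (combine l u) \<le> (\<Sum>i\<in>UNIV. norm (l $ i *\<^sub>R u $ i))"
    unfolding combine_def by (rule norm_sum)
  also have "\<dots> \<le> (\<Sum>i\<in>UNIV. norm (u $ i))"
    using prob_simplex_bounds[OF assms] by (intro sum_mono) (simp add: mult_left_le_one_le)
  finally show ?thesis .
qed

text \<open>Jensen's inequality for the square, then each weight is at most 1. The bound no longer
  contains the weights, which depend on the sample, so expectations can be taken term by
  term.\<close>

lemma norm_combine_sq_le_sum:
  assumes "l \<in> prob_simplex"
  shows "(norm (combine l u))\<^sup>2 \<le> (\<Sum>i\<in>UNIV. (norm (u $ i))\<^sup>2)"
proof -
  have "norm (combine l u) \<le> (\<Sum>i\<in>UNIV. l $ i *\<^sub>R norm (u $ i))"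
    unfolding combine_def using prob_simplex_bounds[OF assms]
    by (intro order_trans[OF norm_sum] sum_mono) simp
  then have "(norm (combine l u))\<^sup>2 \<le> (\<Sum>i\<in>UNIV. l $ i *\<^sub>R norm (u $ i))\<^sup>2"
    by (intro power_mono) auto
  also have "\<dots> \<le> (\<Sum>i\<in>UNIV. l $ i * (norm (u $ i))\<^sup>2)"
    using assms by (intro convex_on_sum[OF _ _ convex_power2]) (auto simp: prob_simplex_def)
  also have "\<dots> \<le> (\<Sum>i\<in>UNIV. (norm (u $ i))\<^sup>2)"
    using prob_simplex_bounds[OF assms] by (intro sum_mono) (simp add: mult_left_le_one_le)
  finally show ?thesis .
qed

text \<open>Cauchy-Schwarz over the index \<open>i\<close>. The coefficients are arbitrary because
  the lemma is applied to a difference of two weight vectors.\<close>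

lemma norm_combine_le_norm:
  fixes l :: "real ^ 'm::finite" and v :: "(real ^ 'n::finite) ^ 'm"
  assumes "\<And>i. norm (v $ i) \<le> B"
  shows "norm (combine l v) \<le> sqrt (real CARD('m)) * B * norm l"
proof -
  have B: "0 \<le> B" using order_trans[OF norm_ge_zero assms] .
  have "norm (combine l v) \<le> (\<Sum>i\<in>UNIV. \<bar>l $ i\<bar> * \<bar>B\<bar>)"
    unfolding combine_def using assms
    by (intro order_trans[OF norm_sum] sum_mono) (auto intro!: mult_left_mono order_trans[OF assms])
  also have "\<dots> \<le> L2_set (\<lambda>i. l $ i) UNIV * L2_set (\<lambda>_. B) (UNIV :: 'm set)"
    by (rule L2_set_mult_ineq)
  also have "\<dots> = sqrt (real CARD('m)) * B * norm l"
    using B by (simp add: norm_vec_def L2_set_def real_sqrt_mult)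
  finally show ?thesis .
qed

text \<open>The pathwise core of one iteration: \<open>v\<close> and \<open>l\<close> are the true
  gradients and their weights, \<open>u\<close> and \<open>l'\<close> the sampled ones. The random
  errors stay on the right as plain sums of norms, ready to be integrated.\<close>

lemma projected_step_le:
  fixes l l' :: "real ^ 'm::finite" and u v :: "(real ^ 'n::finite) ^ 'm"
  assumes X: "convex X" "closed X" "z \<in> X"
    and l: "l \<in> prob_simplex" "l' \<in> prob_simplex"
    and "\<alpha> \<ge> 0" "\<beta> \<ge> 0"
    and \<Theta>: "norm (y - z) \<le> \<Theta>"
    and lip: "norm (l' - l) \<le> \<beta> * norm (u - v)"
    and B: "\<And>i. norm (v $ i) \<le> B"
    and f: "\<And>i. f i y + v $ i \<bullet> (z - y) \<le> f i z"
  shows "(norm (closest_point X (y - \<alpha> *\<^sub>R combine l' u) - z))\<^sup>2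
      + 2 * \<alpha> * (weighted_sum f y l - weighted_sum f z l)
    \<le> (norm (y - z))\<^sup>2 + \<alpha>\<^sup>2 * (\<Sum>i\<in>UNIV. (norm (u $ i))\<^sup>2)
      + 2 * \<alpha> * \<Theta> * (1 + \<beta> * (sqrt (real CARD('m)) * B)) * (\<Sum>i\<in>UNIV. norm (u $ i - v $ i))"
proof -
  define p where "p = combine l' u"
  define E where "E = (\<Sum>i\<in>UNIV. norm (u $ i - v $ i))"
  define K where "K = 1 + \<beta> * (sqrt (real CARD('m)) * B)"
  have B0: "0 \<le> B" using order_trans[OF norm_ge_zero B] .
  \<comment> \<open>The projection is nonexpansive and fixes \<open>z\<close>.\<close>
  have "norm (closest_point X (y - \<alpha> *\<^sub>R p) - z) \<le> norm (y - \<alpha> *\<^sub>R p - z)"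
    using closest_point_lipschitz[OF X(1,2), of "y - \<alpha> *\<^sub>R p" z] X(3)
    by (auto simp: closest_point_self dist_norm)
  then have "(norm (closest_point X (y - \<alpha> *\<^sub>R p) - z))\<^sup>2 \<le> (norm (y - z - \<alpha> *\<^sub>R p))\<^sup>2"
    by (intro power_mono) (auto simp: algebra_simps)
  also have "\<dots> = (norm (y - z))\<^sup>2 - 2 * \<alpha> * (p \<bullet> (y - z)) + \<alpha>\<^sup>2 * (norm p)\<^sup>2"
    unfolding power2_norm_eq_inner
    by (simp add: inner_diff_left inner_diff_right inner_commute algebra_simps power2_eq_square)
  finally have proj: "(norm (closest_point X (y - \<alpha> *\<^sub>R p) - z))\<^sup>2 \<le> \<dots>" .
  have "weighted_sum f y l - weighted_sum f z l = (\<Sum>i\<in>UNIV. l $ i * (f i y - f i z))"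
    by (simp add: weighted_sum_def sum_subtractf right_diff_distrib)
  also have "\<dots> \<le> (\<Sum>i\<in>UNIV. l $ i * (v $ i \<bullet> (y - z)))"
  proof (intro sum_mono mult_left_mono prob_simplex_bounds[OF l(1)])
    fix i show "f i y - f i z \<le> v $ i \<bullet> (y - z)"
      using f[of i] by (simp add: inner_diff_right)
  qed
  also have "\<dots> = combine l v \<bullet> (y - z)"
    by (simp add: combine_def inner_sum_left)
  finally have conv: "weighted_sum f y l - weighted_sum f z l \<le> combine l v \<bullet> (y - z)" .
  \<comment> \<open>The norm of a tuple is at most the sum of the norms of its blocks, so the change
    of weights is measured by the same error \<open>E\<close> as the gradients.\<close>
  have "norm (u - v) \<le> (\<Sum>i\<in>UNIV. norm ((u - v) $ i))"
    unfolding norm_vec_def by (rule L2_set_le_sum) auto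
  then have "norm (l' - l) \<le> \<beta> * E"
    using lip \<open>\<beta> \<ge> 0\<close> by (auto simp: E_def intro: order_trans mult_left_mono)
  then have "norm (combine (l' - l) v) \<le> sqrt (real CARD('m)) * B * (\<beta> * E)"
    using B0 by (intro order_trans[OF norm_combine_le_norm[OF B]] mult_left_mono) auto
  moreover have "norm (combine l' (u - v)) \<le> E"
    using norm_combine_le_sum[OF l(2), of "u - v"] by (simp add: E_def)
  \<comment> \<open>Inserting \<open>combine l' v\<close> separates the gradient error at fixed
    weights from the change of weights at fixed gradients.\<close>
  moreover have "norm (combine l v - p) = norm (combine l' (u - v) + combine (l' - l) v)"
    by (subst norm_minus_commute) (simp add: p_def combine_diff combine_diff_right)
  ultimately have dev: "norm (combine l v - p) \<le> K * E"
    unfolding K_def using norm_triangle_ineq[of "combine l' (u - v)" "combine (l' - l) v"]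
    by (simp add: algebra_simps)
  have "combine l v \<bullet> (y - z) - p \<bullet> (y - z) = (combine l v - p) \<bullet> (y - z)"
    by (simp add: inner_diff_left)
  also have "\<dots> \<le> norm (combine l v - p) * norm (y - z)"
    by (rule norm_cauchy_schwarz)
  also have "\<dots> \<le> K * E * \<Theta>"
    using dev \<Theta> by (intro mult_mono) (auto intro: order_trans[OF norm_ge_zero])
  finally have "weighted_sum f y l - weighted_sum f z l - p \<bullet> (y - z) \<le> K * E * \<Theta>"
    using conv by linarith
  then have "2 * \<alpha> * (weighted_sum f y l - weighted_sum f z l - p \<bullet> (y - z)) \<le> 2 * \<alpha> * (K * E * \<Theta>)"
    using \<open>\<alpha> \<ge> 0\<close> by (intro mult_left_mono) auto
  moreover have "\<alpha>\<^sup>2 * (norm p)\<^sup>2 \<le> \<alpha>\<^sup>2 * (\<Sum>i\<in>UNIV. (norm (u $ i))\<^sup>2)"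
    using norm_combine_sq_le_sum[OF l(2), of u] by (intro mult_left_mono) (auto simp: p_def)
  ultimately show ?thesis
    using proj unfolding p_def[symmetric] E_def[symmetric] K_def[symmetric]
    by (simp add: algebra_simps)
qed

section \<open>Independence of the iterate and the fresh sample, and Fubini\<close>

text \<open>The state at time \<open>k\<close> depends only on the samples
  \<open>m, ..., k - 1\<close>, and disjoint blocks of an independent family are
  independent.\<close>

lemma (in prob_space) joint_distr_of_recursion:
  fixes w :: "nat \<Rightarrow> 'a \<Rightarrow> 'b" and x :: "nat \<Rightarrow> 'a \<Rightarrow> 'c"
  assumes indep: "indep_vars (\<lambda>_. N) w {m..}"
    and meas: "\<And>k. k \<ge> m \<Longrightarrow> (\<lambda>(y, \<xi>). step k y \<xi>) \<in> measurable (S \<Otimes>\<^sub>M N) S"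
    and init: "c \<in> space S" "\<And>\<omega>. \<omega> \<in> space M \<Longrightarrow> x m \<omega> = c"
    and rec: "\<And>k \<omega>. k \<ge> m \<Longrightarrow> \<omega> \<in> space M \<Longrightarrow> x (Suc k) \<omega> = step k (x k \<omega>) (w k \<omega>)"
    and "k \<ge> m"
  shows "random_variable S (x k)"
    and "distr M S (x k) \<Otimes>\<^sub>M distr M N (w k) = distr M (S \<Otimes>\<^sub>M N) (\<lambda>\<omega>. (x k \<omega>, w k \<omega>))"
proof -
  have w: "random_variable N (w k)" if "k \<ge> m" for k
    using indep that by (auto simp: indep_vars_def)
  \<comment> \<open>The state factors measurably through the product space of past samples; at time
    \<open>m\<close> the index set is empty and the map constant.\<close>
  have "\<exists>F \<in> measurable (Pi\<^sub>M {m..<k} (\<lambda>_. N)) S.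
      \<forall>\<omega>\<in>space M. x k \<omega> = F (restrict (\<lambda>i. w i \<omega>) {m..<k})"
    using \<open>k \<ge> m\<close>
  proof (induction k rule: dec_induct)
    case base
    then show ?case using init by (intro bexI[of _ "\<lambda>_. c"]) auto
  next
    case (step k)
    then obtain F where F: "F \<in> measurable (Pi\<^sub>M {m..<k} (\<lambda>_. N)) S"
      "\<And>\<omega>. \<omega> \<in> space M \<Longrightarrow> x k \<omega> = F (restrict (\<lambda>i. w i \<omega>) {m..<k})" by blast
    let ?P = "Pi\<^sub>M {m..<Suc k} (\<lambda>_. N)"
    \<comment> \<open>The history is cut back to the earlier coordinates for \<open>F\<close>, and
      the newest coordinate drives the step.\<close>
    define F' where "F' h = step k (F (restrict h {m..<k})) (h k)" for h
    have "(\<lambda>h. F (restrict h {m..<k})) \<in> measurable ?P S"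
      by (rule measurable_compose[OF measurable_restrict_subset F(1)]) auto
    moreover have "(\<lambda>h. h k) \<in> measurable ?P N"
      using step(1) by (intro measurable_component_singleton) auto
    ultimately have "(\<lambda>h. (F (restrict h {m..<k}), h k)) \<in> measurable ?P (S \<Otimes>\<^sub>M N)"
      by simp
    from measurable_compose[OF this meas[OF step(1)]] have "F' \<in> measurable ?P S"
      by (simp add: F'_def[abs_def])
    moreover have "x (Suc k) \<omega> = F' (restrict (\<lambda>i. w i \<omega>) {m..<Suc k})" if "\<omega> \<in> space M" for \<omega>
    proof -
      have "restrict (restrict (\<lambda>i. w i \<omega>) {m..<Suc k}) {m..<k} = restrict (\<lambda>i. w i \<omega>) {m..<k}"
        by (auto simp: restrict_def)
      then show ?thesis
        using rec[OF step(1) that] F(2)[OF that] step(1) by (simp add: F'_def)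
    qed
    ultimately show ?case by blast
  qed
  then obtain F where F: "F \<in> measurable (Pi\<^sub>M {m..<k} (\<lambda>_. N)) S"
    "\<And>\<omega>. \<omega> \<in> space M \<Longrightarrow> x k \<omega> = F (restrict (\<lambda>i. w i \<omega>) {m..<k})" by blast
  define p where "p \<omega> = restrict (\<lambda>i. w i \<omega>) {m..<k}" for \<omega>
  \<comment> \<open>The single sample is treated as a block indexed by \<open>{k}\<close>, so that
    independence of disjoint blocks applies; evaluation at \<open>k\<close> recovers
    \<open>w k\<close>.\<close>
  define q where "q \<omega> = restrict (\<lambda>i. w i \<omega>) {k}" for \<omega>
  let ?P = "Pi\<^sub>M {m..<k} (\<lambda>_. N)" and ?Q = "Pi\<^sub>M {k} (\<lambda>_. N)"
  have "indep_var ?P p ?Q q"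
    unfolding p_def q_def using \<open>k \<ge> m\<close> by (intro indep_var_restrict[OF indep]) auto
  then have p: "random_variable ?P p" and q: "random_variable ?Q q"
    and pq: "distr M ?P p \<Otimes>\<^sub>M distr M ?Q q = distr M (?P \<Otimes>\<^sub>M ?Q) (\<lambda>\<omega>. (p \<omega>, q \<omega>))"
    unfolding indep_var_distribution_eq by auto
  have x: "x k \<omega> = F (p \<omega>)" if "\<omega> \<in> space M" for \<omega>
    using F(2)[OF that] by (simp add: p_def)
  have qk: "q \<omega> k = w k \<omega>" for \<omega>
    by (simp add: q_def)
  have eval: "(\<lambda>h. h k) \<in> measurable ?Q N"
    by (intro measurable_component_singleton) auto
  show rv: "random_variable S (x k)"
    using measurable_compose[OF p F(1)] x by (simp cong: measurable_cong)
  have "distr M S (x k) = distr (distr M ?P p) S F"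
    using x by (subst distr_distr[OF F(1) p]) (auto intro!: distr_cong)
  moreover have "distr M N (w k) = distr (distr M ?Q q) N (\<lambda>h. h k)"
    by (subst distr_distr[OF eval q]) (auto intro!: distr_cong simp: qk)
  moreover have "distr (distr M ?P p) S F \<Otimes>\<^sub>M distr (distr M ?Q q) N (\<lambda>h. h k)
      = distr (distr M ?P p \<Otimes>\<^sub>M distr M ?Q q) (S \<Otimes>\<^sub>M N) (\<lambda>(h, h'). (F h, h' k))"
    using F(1) eval prob_space.prob_space_distr[OF prob_space_distr[OF q], of "\<lambda>h. h k" N]
    by (intro pair_measure_distr prob_space_imp_sigma_finite) auto
  moreover have "\<dots> = distr M (S \<Otimes>\<^sub>M N) (\<lambda>\<omega>. (x k \<omega>, w k \<omega>))"
    unfolding pq using F(1) eval p q x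
    by (subst distr_distr) (auto intro!: distr_cong simp: qk)
  ultimately show "distr M S (x k) \<Otimes>\<^sub>M distr M N (w k)
      = distr M (S \<Otimes>\<^sub>M N) (\<lambda>\<omega>. (x k \<omega>, w k \<omega>))"
    by simp
qed

text \<open>A bound on the integral over the sample, with the state frozen, carries over to the
  joint expectation. Since \<open>h\<close> is nonnegative, Tonelli applies before integrability is
  known, and integrability comes out as a conclusion.\<close>

lemma (in prob_space) integral_le_of_product_distr:
  fixes h :: "'c \<Rightarrow> 'b \<Rightarrow> real"
    and Y :: "'a \<Rightarrow> 'c" and W :: "'a \<Rightarrow> 'b"
  assumes rv [measurable]: "random_variable S Y" "random_variable N W"
    and law: "distr M N W = N"
    and joint: "distr M S Y \<Otimes>\<^sub>M distr M N W = distr M (S \<Otimes>\<^sub>M N) (\<lambda>\<omega>. (Y \<omega>, W \<omega>))"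
    and h: "(\<lambda>(y, \<xi>). h y \<xi>) \<in> borel_measurable (S \<Otimes>\<^sub>M N)" "\<And>y \<xi>. 0 \<le> h y \<xi>"
    and bound: "AE \<omega> in M. integrable N (h (Y \<omega>)) \<and> (\<integral>\<xi>. h (Y \<omega>) \<xi> \<partial>N) \<le> c"
  shows "integrable M (\<lambda>\<omega>. h (Y \<omega>) (W \<omega>))" "(\<integral>\<omega>. h (Y \<omega>) (W \<omega>) \<partial>M) \<le> c"
proof -
  interpret N: prob_space N
    using prob_space_distr[OF rv(2)] law by simp
  have h' [measurable]: "(\<lambda>p. h (fst p) (snd p)) \<in> borel_measurable (S \<Otimes>\<^sub>M N)"
    using h(1) by (simp add: case_prod_beta')
  \<comment> \<open>A constant statement that holds almost everywhere on a probability space is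
    true; the sign is needed to return from \<open>ennreal\<close> to the reals.\<close>
  have c: "0 \<le> c"
  proof -
    have "AE \<omega> in M. 0 \<le> c"
      using bound by eventually_elim (use h(2) in \<open>auto intro: order_trans[OF Bochner_Integration.integral_nonneg]\<close>)
    then show ?thesis by simp
  qed
  have "(\<integral>\<^sup>+\<omega>. ennreal (h (Y \<omega>) (W \<omega>)) \<partial>M)
      = (\<integral>\<^sup>+p. ennreal (h (fst p) (snd p)) \<partial>(distr M S Y \<Otimes>\<^sub>M N))"
    unfolding joint[unfolded law] by (subst nn_integral_distr) auto
  also have "\<dots> = (\<integral>\<^sup>+y. \<integral>\<^sup>+\<xi>. ennreal (h y \<xi>) \<partial>N \<partial>distr M S Y)"
    by (subst N.nn_integral_fst[symmetric]) (auto cong: measurable_cong_sets)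
  also have "\<dots> = (\<integral>\<^sup>+\<omega>. \<integral>\<^sup>+\<xi>. ennreal (h (Y \<omega>) \<xi>) \<partial>N \<partial>M)"
    by (subst nn_integral_distr) auto
  also have "\<dots> \<le> (\<integral>\<^sup>+\<omega>. ennreal c \<partial>M)"
    using bound by (intro nn_integral_mono_AE, eventually_elim)
      (auto simp: nn_integral_eq_integral h(2) ennreal_leI)
  also have "\<dots> = ennreal c"
    by (simp add: emeasure_space_1)
  finally have le: "(\<integral>\<^sup>+\<omega>. ennreal (h (Y \<omega>) (W \<omega>)) \<partial>M) \<le> ennreal c" .
  have meas: "(\<lambda>\<omega>. h (Y \<omega>) (W \<omega>)) \<in> borel_measurable M"
    using measurable_compose[OF measurable_Pair[OF rv] h'] by simp
  then show "integrable M (\<lambda>\<omega>. h (Y \<omega>) (W \<omega>))"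
    using le h(2) by (intro integrableI_nonneg) (auto simp: top.not_eq_extremum intro: le_less_trans)
  show "(\<integral>\<omega>. h (Y \<omega>) (W \<omega>) \<partial>M) \<le> c"
    using le h(2) c meas by (subst integral_eq_nn_integral) (auto simp: enn2real_leI)
qed

section \<open>Measurability of weights and combinations\<close>

text \<open>\<open>A\<close> may fail to be Borel, but its closure is Borel, and a Lipschitz map
  into a complete space extends continuously to the closure. Outside it any constant will
  do.\<close>

lemma lipschitz_on_measurable_extension:
  fixes \<Lambda> :: "'a::metric_space \<Rightarrow> 'b::complete_space"
  assumes "C-lipschitz_on A \<Lambda>"
  obtains H :: "'a \<Rightarrow> 'b" where "H \<in> borel_measurable borel" "\<And>v. v \<in> A \<Longrightarrow> H v = \<Lambda> v"
proof -
  obtain g where g: "C-lipschitz_on (closure A) g" "\<forall>v\<in>A. g v = \<Lambda> v"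
    using lipschitz_extend_closure[OF assms] by blast
  have "(\<lambda>v. if v \<in> closure A then g v else undefined) \<in> borel_measurable borel"
    using g(1) by (intro borel_measurable_continuous_on_if continuous_on_const
      lipschitz_on_continuous_on) auto
  then show thesis
    by (rule that) (use g(2) closure_subset[of A] in auto)
qed


text \<open>A tuple is the finite sum of its blocks embedded along the axes, and each embedding is
  continuous.\<close>

lemma borel_measurable_vec_lambda [measurable]:
  fixes u :: "'a \<Rightarrow> 'm::finite \<Rightarrow> 'b::euclidean_space"
  assumes "\<And>i. (\<lambda>p. u p i) \<in> borel_measurable N"
  shows "(\<lambda>p. \<chi> i. u p i) \<in> borel_measurable N"
proof -
  have "(\<lambda>p. \<chi> i. u p i) = (\<lambda>p. \<Sum>i\<in>UNIV. axis i (u p i))"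
    by (rule ext) (auto simp: vec_eq_iff axis_def if_distrib cong: if_cong)
  moreover have "(\<lambda>p. axis i (u p i)) \<in> borel_measurable N" for i
  proof (rule borel_measurable_continuous_on[OF _ assms])
    have "continuous_on UNIV (\<lambda>y::'b. if j = i then y else 0)" for j :: 'm
      by (cases "j = i") auto
    then show "continuous_on UNIV (axis i :: 'b \<Rightarrow> _)"
      unfolding axis_def by (intro continuous_on_vec_lambda)
  qed
  ultimately show ?thesis by simp
qed

lemma borel_measurable_vec_nth [measurable (raw)]:
  fixes u :: "'a \<Rightarrow> 'b::euclidean_space ^ 'm::finite"
  assumes "u \<in> borel_measurable N"
  shows "(\<lambda>p. u p $ i) \<in> borel_measurable N"
  by (rule borel_measurable_continuous_on[OF _ assms]) (intro continuous_intros)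

lemma borel_measurable_combine [measurable (raw)]:
  fixes l :: "'a \<Rightarrow> real ^ 'm::finite" and u :: "'a \<Rightarrow> (real ^ 'n::finite) ^ 'm"
  assumes [measurable]: "l \<in> borel_measurable N" "u \<in> borel_measurable N"
  shows "(\<lambda>p. combine (l p) (u p)) \<in> borel_measurable N"
  unfolding combine_def by measurable

lemma borel_measurable_weighted_sum [measurable (raw)]:
  fixes l :: "'a \<Rightarrow> real ^ 'm::finite" and f :: "'m \<Rightarrow> real ^ 'n::finite \<Rightarrow> real"
  assumes [measurable]: "\<And>i. f i \<in> borel_measurable borel"
    "x \<in> borel_measurable N" "l \<in> borel_measurable N"
  shows "(\<lambda>p. weighted_sum f (x p) (l p)) \<in> borel_measurable N"
  unfolding weighted_sum_def by measurable

section \<open>Integrability and averaging of the scalarized objective\<close>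

lemma abs_weighted_sum_le:
  assumes "l \<in> prob_simplex"
  shows "\<bar>weighted_sum f y l\<bar> \<le> (\<Sum>i\<in>UNIV. \<bar>f i y\<bar>)"
proof -
  have "\<bar>weighted_sum f y l\<bar> \<le> (\<Sum>i\<in>UNIV. \<bar>l $ i * f i y\<bar>)"
    unfolding weighted_sum_def by (rule sum_abs)
  also have "\<dots> \<le> (\<Sum>i\<in>UNIV. \<bar>f i y\<bar>)"
    using prob_simplex_bounds[OF assms] by (intro sum_mono) (simp add: abs_mult mult_left_le_one_le)
  finally show ?thesis .
qed

text \<open>Compactness of \<open>X\<close> bounds the integrand by a constant that does not depend
  on the weights.\<close>

lemma (in prob_space) integrable_weighted_sum:
  fixes f :: "'m::finite \<Rightarrow> real ^ 'n::finite \<Rightarrow> real"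
  assumes X: "compact X" "\<And>i. continuous_on UNIV (f i)"
    and x: "x \<in> borel_measurable M" "\<And>\<omega>. \<omega> \<in> space M \<Longrightarrow> x \<omega> \<in> X"
    and l: "l \<in> borel_measurable M" "\<And>\<omega>. \<omega> \<in> space M \<Longrightarrow> l \<omega> \<in> prob_simplex"
  shows "integrable M (\<lambda>\<omega>. weighted_sum f (x \<omega>) (l \<omega>))"
proof -
  have "compact ((\<lambda>y. \<Sum>i\<in>UNIV. \<bar>f i y\<bar>) ` X)"
    by (intro compact_continuous_image X continuous_intros continuous_on_subset[OF X(2)]) auto
  then obtain K where "\<forall>s\<in>(\<lambda>y. \<Sum>i\<in>UNIV. \<bar>f i y\<bar>) ` X. norm s \<le> K"
    by (meson compact_imp_bounded bounded_iff)
  then have K: "(\<Sum>i\<in>UNIV. \<bar>f i y\<bar>) \<le> K" if "y \<in> X" for y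
    using that by (auto dest: abs_le_D1)
  show ?thesis
  proof (rule integrable_const_bound[of _ K])
    show "AE \<omega> in M. norm (weighted_sum f (x \<omega>) (l \<omega>)) \<le> K"
    proof (rule AE_I2)
      fix \<omega> assume "\<omega> \<in> space M"
      then show "norm (weighted_sum f (x \<omega>) (l \<omega>)) \<le> K"
        using order_trans[OF abs_weighted_sum_le[of "l \<omega>" f "x \<omega>"] K] x(2) l(2) by simp
    qed
    show "(\<lambda>\<omega>. weighted_sum f (x \<omega>) (l \<omega>)) \<in> borel_measurable M"
      using x l borel_measurable_continuous_onI[OF X(2)] by measurable
  qed
qed

text \<open>Linearity in the weights turns the value at averaged weights into an average of
  values.\<close>

lemma weighted_sum_average:
  "weighted_sum f y ((1 / r) *\<^sub>R (\<Sum>s\<in>I. l s)) = (\<Sum>s\<in>I. weighted_sum f y (l s)) / r"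
  unfolding weighted_sum_def sum_divide_distrib
  by (subst sum.swap) (simp add: sum_divide_distrib sum_distrib_right)

lemma prob_simplex_average:
  assumes "finite I" "I \<noteq> {}" "\<And>s. s \<in> I \<Longrightarrow> l s \<in> prob_simplex"
  shows "(1 / real (card I)) *\<^sub>R (\<Sum>s\<in>I. l s) \<in> prob_simplex"
proof -
  have "(\<Sum>i\<in>UNIV. \<Sum>s\<in>I. l s $ i) = real (card I)"
    using assms(3) by (subst sum.swap) (simp add: prob_simplex_def)
  then show ?thesis
    using assms by (simp add: prob_simplex_def sum_divide_distrib[symmetric] sum_nonneg)
qed

lemma Min_le_average:
  fixes e :: "'b \<Rightarrow> real"
  assumes "finite I" "I \<noteq> {}"
  shows "Min (e ` I) \<le> (\<Sum>s\<in>I. e s) / card I"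
proof -
  have "card I * Min (e ` I) \<le> (\<Sum>s\<in>I. e s)"
    using assms by (intro sum_bounded_below) auto
  then show ?thesis
    using assms by (simp add: field_simps card_gt_0_iff)
qed

section \<open>The rate of the stochastic multi-gradient method\<close>

theorem theorem5p3:
  fixes M :: "'a measure" and D :: "'w measure"
    and X :: "(real ^ 'n::finite) set"
    and \<phi> :: "'m::finite \<Rightarrow> real ^ 'n \<Rightarrow> 'w \<Rightarrow> real"
    and f :: "'m \<Rightarrow> real ^ 'n \<Rightarrow> real"
    and df :: "'m \<Rightarrow> real ^ 'n \<Rightarrow> real ^ 'n"
    and g :: "'m \<Rightarrow> real ^ 'n \<Rightarrow> 'w \<Rightarrow> real ^ 'n"
    and w :: "nat \<Rightarrow> 'a \<Rightarrow> 'w"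
    and x :: "nat \<Rightarrow> 'a \<Rightarrow> real ^ 'n"
    and lg lam lambar :: "nat \<Rightarrow> 'a \<Rightarrow> real ^ 'm"
    and \<Lambda> :: "(real ^ 'n) ^ 'm \<Rightarrow> real ^ 'm"
    and \<alpha> :: "nat \<Rightarrow> real"
    and Ls C Chat Gs Ghat :: "'m \<Rightarrow> real"
    and \<alpha>bar \<beta> \<Theta> L M_nabla M1 M_F G G_V L_nablaS L_g M_S :: real
    and x1 x0 xstar :: "real ^ 'n"
  assumes m_ge_2: "CARD('m) \<ge> 2"
    and X: "X \<noteq> {}" "closed X" "convex X"
    \<comment> \<open>\<open>D\<close> is the law of \<open>w\<close>\<close>
    and prob: "prob_space M" "prob_space D"
    and iid: "prob_space.indep_vars M (\<lambda>_. D) w {1..}"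
             "\<And>k. k \<ge> 1 \<Longrightarrow> distr M D (w k) = D"
    and objective: "\<And>i y. integrable D (\<phi> i y)"
                   "\<And>i y. f i y = (\<integral>\<xi>. \<phi> i y \<xi> \<partial>D)"
    and g_measurable:
      "\<And>i. (\<lambda>(y, \<xi>). g i y \<xi>) \<in> borel_measurable (borel \<Otimes>\<^sub>M D)"
    \<comment> \<open>algorithm\<close>
    and \<alpha>bar_pos: "\<alpha>bar > 0"
    and \<alpha>: "\<And>k. k \<ge> 1 \<Longrightarrow> \<alpha> k = \<alpha>bar / sqrt (real k)"
    and run: "smg_run M X \<alpha> g w x1 x lg"
    and lam: "\<And>k \<omega>. k \<ge> 1 \<Longrightarrow> \<omega> \<in> space M \<Longrightarrow>
                lam k \<omega> \<in> min_norm_weights (\<chi> i. df i (x k \<omega>))"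
    \<comment> \<open>Lipschitz gradients\<close>
    and gradient: "\<And>i y. GDERIV (f i) y :> df i y" "\<And>i. continuous_on UNIV (df i)"
    and Ls: "\<And>i. Ls i > 0" "\<And>i. (Ls i)-lipschitz_on UNIV (df i)"
    \<comment> \<open>stochastic gradients\<close>
    and unbiased: "\<And>i k. k \<ge> 1 \<Longrightarrow> AE \<omega> in M.
          integrable D (g i (x k \<omega>)) \<and> (\<integral>\<xi>. g i (x k \<omega>) \<xi> \<partial>D) = df i (x k \<omega>)"
    and C: "\<And>i. C i > 0" "\<And>i. Chat i > 0"
        "\<And>i k. k \<ge> 1 \<Longrightarrow> AE \<omega> in M.
          (\<integral>\<xi>. norm (g i (x k \<omega>) \<xi> - df i (x k \<omega>)) \<partial>D)
            \<le> \<alpha> k * (C i + Chat i * norm (df i (x k \<omega>)))"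
    and Gs: "\<And>i. Gs i > 0" "\<And>i. Ghat i > 0"
        "\<And>i k. k \<ge> 1 \<Longrightarrow> AE \<omega> in M.
          integrable D (\<lambda>\<xi>. (norm (g i (x k \<omega>) \<xi>))\<^sup>2) \<and>
          vec_variance D (g i (x k \<omega>)) \<le> (Gs i)\<^sup>2 + (Ghat i)\<^sup>2 * (norm (df i (x k \<omega>)))\<^sup>2"
    \<comment> \<open>bounded feasible region\<close>
    and \<Theta>: "bounded X" "\<Theta> > 0" "\<And>y z. y \<in> X \<Longrightarrow> z \<in> X \<Longrightarrow> norm (y - z) \<le> \<Theta>"
    \<comment> \<open>subproblem Lipschitz continuity\<close>
    and \<Lambda>: "\<And>v. v \<in> arising_tuples M X df g w x \<Longrightarrow> \<Lambda> v \<in> min_norm_weights v"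
        "\<beta> > 0" "\<beta>-lipschitz_on (arising_tuples M X df g w x) \<Lambda>"
        "\<And>k \<omega>. k \<ge> 1 \<Longrightarrow> \<omega> \<in> space M \<Longrightarrow> lam k \<omega> = \<Lambda> (\<chi> i. df i (x k \<omega>))"
        "\<And>k \<omega>. k \<ge> 1 \<Longrightarrow> \<omega> \<in> space M \<Longrightarrow> lg k \<omega> = \<Lambda> (\<chi> i. g i (x k \<omega>) (w k \<omega>))"
    \<comment> \<open>convexity\<close>
    and convex: "\<And>i. convex_on UNIV (f i)"
        "\<And>l. l \<in> prob_simplex \<Longrightarrow>
          \<exists>y. \<forall>z. weighted_sum f y l \<le> weighted_sum f z l"
    \<comment> \<open>constants\<close>
    and L: "L = Max (range Ls)"
    and M_nabla: "x0 \<in> X" "M_nabla = Max (range (\<lambda>i. norm (df i x0)))"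
    and M1: "M1 = (\<Sum>i\<in>UNIV. C i)"
    and M_F: "M_F = Max (range Chat)"
    and G: "G\<^sup>2 = real CARD('m) * (\<Sum>i\<in>UNIV. (Gs i)\<^sup>2)"
    and G_V: "G_V\<^sup>2 = real CARD('m) * Max (range (\<lambda>i. (Ghat i)\<^sup>2 + 1))"
    and L_nablaS: "L_nablaS = M1 + real CARD('m) * M_F * (M_nabla + L * \<Theta>)"
    and L_g: "L_g\<^sup>2 = G\<^sup>2 + real CARD('m) * G_V\<^sup>2 * (M_nabla + L * \<Theta>)\<^sup>2"
    and M_S: "M_S = sqrt (real CARD('m) * real CARD('n)) * (M_nabla + L * \<Theta>)"
    and xstar: "xstar \<in> X"
    and lambar: "\<And>k \<omega>. lambar k \<omega> = (1 / real k) *\<^sub>R (\<Sum>s=1..k. lam s \<omega>)"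
  shows "\<forall>k\<ge>1.
      (\<forall>\<omega>\<in>space M. lambar k \<omega> \<in> prob_simplex) \<and>
      (MIN s\<in>{1..k}. \<integral>\<omega>. weighted_sum f (x s \<omega>) (lam s \<omega>) \<partial>M)
        - (\<integral>\<omega>. weighted_sum f xstar (lambar k \<omega>) \<partial>M)
      \<le> (\<Theta>\<^sup>2 / (2 * \<alpha>bar)
          + \<alpha>bar * (L_g\<^sup>2 + 2 * \<Theta> * (L_nablaS + \<beta> * L_nablaS * M_S))) / sqrt (real k)"
proof -
  interpret M: prob_space M by fact
  interpret D: prob_space D by fact
  define A where "A = arising_tuples M X df g w x"
  define tup where "tup y \<xi> = (\<chi> i. g i y \<xi>)" for y \<xi>
  define grad where "grad y = (\<chi> i. df i y)" for y
  \<comment> \<open>\<open>B\<close> will bound all true gradients on \<open>X\<close>: the largest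
    norm at \<open>x0\<close> plus the Lipschitz change over the diameter.\<close>
  define B where "B = M_nabla + L * \<Theta>"
  define m where "m = real CARD('m)"

  have run_rec: "x (Suc k) \<omega> = closest_point X (x k \<omega> - \<alpha> k *\<^sub>R combine (lg k \<omega>) (tup (x k \<omega>) (w k \<omega>)))"
    if "k \<ge> 1" "\<omega> \<in> space M" for k \<omega>
    using run that by (simp add: smg_run_def tup_def)
  have xX: "x k \<omega> \<in> X" if "k \<ge> 1" "\<omega> \<in> space M" for k \<omega>
    using that(1)
  proof (induction k rule: dec_induct)
    case base
    then show ?case using run that(2) by (simp add: smg_run_def)
  next
    case (step k)
    then show ?case using run_rec that(2) closest_point_in_set[OF X(2,1)] by simp
  qed
  have inA: "tup (x k \<omega>) (w k \<omega>) \<in> A" "grad (x k \<omega>) \<in> A" if "k \<ge> 1" "\<omega> \<in> space M" for k \<omega>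
    using that xX[OF that] unfolding A_def arising_tuples_def tup_def grad_def by blast+
  have lg_eq: "lg k \<omega> = \<Lambda> (tup (x k \<omega>) (w k \<omega>))" and lam_eq: "lam k \<omega> = \<Lambda> (grad (x k \<omega>))"
    if "k \<ge> 1" "\<omega> \<in> space M" for k \<omega>
    using \<Lambda>(4,5)[OF that] by (simp_all add: tup_def grad_def)
  have simplex: "lg k \<omega> \<in> prob_simplex" "lam k \<omega> \<in> prob_simplex"
    if "k \<ge> 1" "\<omega> \<in> space M" for k \<omega>
    using \<Lambda>(1) inA[OF that] lg_eq[OF that] lam_eq[OF that]
    by (auto simp: A_def min_norm_weights_def is_arg_min_def)

  \<comment> \<open>\<open>\<Lambda>\<close> is controlled only on the set \<open>A\<close>, which need not be measurable.\<close>
  obtain H where H [measurable]: "H \<in> borel_measurable borel" and H_eq: "\<And>v. v \<in> A \<Longrightarrow> H v = \<Lambda> v"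
    using lipschitz_on_measurable_extension[OF \<Lambda>(3)] unfolding A_def by blast
  have df_meas [measurable]: "df i \<in> borel_measurable borel" for i
    by (rule borel_measurable_continuous_onI) (rule gradient(2))
  have g_meas [measurable]: "(\<lambda>p. g i (fst p) (snd p)) \<in> borel_measurable (borel \<Otimes>\<^sub>M D)" for i
    using g_measurable[of i] by (simp add: case_prod_beta')
  have f_cont: "continuous_on UNIV (f i)" for i
    using gradient(1) unfolding gderiv_def
    by (meson continuous_at_imp_continuous_on has_derivative_continuous)
  have proj_meas [measurable]: "closest_point X \<in> borel_measurable borel"
    by (intro borel_measurable_continuous_onI continuous_on_closest_point X)

  \<comment> \<open>With \<open>H\<close> in place of \<open>\<Lambda>\<close> the update is
    measurable everywhere and still agrees with the algorithm along the run.\<close>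
  define step where "step k y \<xi> = closest_point X (y - \<alpha> k *\<^sub>R combine (H (tup y \<xi>)) (tup y \<xi>))" for k y \<xi>
  have step_meas: "(\<lambda>(y, \<xi>). step k y \<xi>) \<in> measurable (borel \<Otimes>\<^sub>M D) borel" for k
    unfolding step_def tup_def case_prod_beta' by measurable
  have x_rec: "x (Suc k) \<omega> = step k (x k \<omega>) (w k \<omega>)" if "k \<ge> 1" "\<omega> \<in> space M" for k \<omega>
    using run_rec[OF that] lg_eq[OF that] H_eq[OF inA(1)[OF that]] by (simp add: step_def)
  have x_init: "x 1 \<omega> = x1" if "\<omega> \<in> space M" for \<omega>
    using run that by (simp add: smg_run_def)
  have x_meas [measurable]: "x k \<in> borel_measurable M"
    and joint: "distr M borel (x k) \<Otimes>\<^sub>M distr M D (w k)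
      = distr M (borel \<Otimes>\<^sub>M D) (\<lambda>\<omega>. (x k \<omega>, w k \<omega>))" if "k \<ge> 1" for k
  proof -
    note law = M.joint_distr_of_recursion[of D w 1 step borel x1 x, OF iid(1) step_meas _ x_init x_rec]
    show "x k \<in> borel_measurable M"
      by (rule law(1)) (use that in simp_all)
    show "distr M borel (x k) \<Otimes>\<^sub>M distr M D (w k)
        = distr M (borel \<Otimes>\<^sub>M D) (\<lambda>\<omega>. (x k \<omega>, w k \<omega>))"
      by (rule law(2)) (use that in simp_all)
  qed
  have w_meas: "w k \<in> measurable M D" if "k \<ge> 1" for k
    using iid(1) that by (auto simp: M.indep_vars_def)
  \<comment> \<open>Moments along the run reduce to integrals over \<open>D\<close> at a frozen
    iterate, the form in which the assumptions are given.\<close>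
  have moment: "integrable M (\<lambda>\<omega>. h (x k \<omega>) (w k \<omega>))" "(\<integral>\<omega>. h (x k \<omega>) (w k \<omega>) \<partial>M) \<le> c"
    if k: "k \<ge> 1" and h: "(\<lambda>p. h (fst p) (snd p)) \<in> borel_measurable (borel \<Otimes>\<^sub>M D)"
      "\<And>y \<xi>. 0 \<le> h y \<xi>"
      and bound: "AE \<omega> in M. integrable D (h (x k \<omega>)) \<and> (\<integral>\<xi>. h (x k \<omega>) \<xi> \<partial>D) \<le> c"
    for k c and h :: "real ^ 'n \<Rightarrow> 'w \<Rightarrow> real"
    using M.integral_le_of_product_distr[OF x_meas[OF k] w_meas[OF k] iid(2)[OF k] joint[OF k]
        _ h(2) bound] h(1)
    by (simp_all add: case_prod_beta')
  have lam_meas: "lam k \<in> borel_measurable M" if "k \<ge> 1" for k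
  proof -
    note [measurable] = x_meas[OF that]
    have "(\<lambda>\<omega>. H (grad (x k \<omega>))) \<in> borel_measurable M"
      unfolding grad_def by measurable
    then show ?thesis
      using lam_eq[OF that] H_eq[OF inA(2)[OF that]] by (simp cong: measurable_cong)
  qed

  \<comment> \<open>Gradient bounds and moments of the stochastic gradients\<close>
  have Ls_le: "Ls i \<le> L" and Chat_le: "Chat i \<le> M_F" and M_nabla_ge: "norm (df i x0) \<le> M_nabla"
    and Ghat_le: "(Ghat i)\<^sup>2 + 1 \<le> Max (range (\<lambda>i. (Ghat i)\<^sup>2 + 1))" for i
    unfolding L M_F M_nabla(2) by (auto intro!: Max_ge)
  have df_le: "norm (df i y) \<le> B" if "y \<in> X" for i y
  proof -
    have "norm (df i y) \<le> norm (df i x0) + norm (df i y - df i x0)"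
      by (rule norm_triangle_sub)
    also have "norm (df i y - df i x0) \<le> Ls i * norm (y - x0)"
      using lipschitz_onD[OF Ls(2)] by (simp add: dist_norm)
    also have "\<dots> \<le> L * \<Theta>"
      using Ls_le[of i] Ls(1)[of i] \<Theta>(3)[OF that M_nabla(1)] by (intro mult_mono) auto
    finally show ?thesis
      using M_nabla_ge[of i] by (simp add: B_def)
  qed
  have B0: "0 \<le> B"
    using order_trans[OF norm_ge_zero df_le[OF xstar]] .
  have m1: "m \<ge> 1" using m_ge_2 by (simp add: m_def)
  have sq_le: "(norm (df i y))\<^sup>2 \<le> B\<^sup>2" if "y \<in> X" for i y
    using df_le[OF that] by (intro power_mono) auto

  have pos: "0 < \<alpha> k" if "k \<ge> 1" for k
    using \<alpha>[OF that] \<alpha>bar_pos that by simp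

  have err: "integrable M (\<lambda>\<omega>. norm (g i (x k \<omega>) (w k \<omega>) - df i (x k \<omega>)))"
      "(\<integral>\<omega>. norm (g i (x k \<omega>) (w k \<omega>) - df i (x k \<omega>)) \<partial>M) \<le> \<alpha> k * (C i + M_F * B)"
    if k: "k \<ge> 1" for k i
  proof -
    have bound: "AE \<omega> in M. integrable D (\<lambda>\<xi>. norm (g i (x k \<omega>) \<xi> - df i (x k \<omega>))) \<and>
        (\<integral>\<xi>. norm (g i (x k \<omega>) \<xi> - df i (x k \<omega>)) \<partial>D) \<le> \<alpha> k * (C i + M_F * B)"
      using C(3)[OF k, of i] unbiased[OF k, of i] AE_space
    proof eventually_elim
      case (elim \<omega>)
      have "Chat i * norm (df i (x k \<omega>)) \<le> M_F * B"
        using Chat_le[of i] C(2)[of i] df_le[OF xX[OF k elim(3)]] by (intro mult_mono) auto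
      then have "\<alpha> k * (C i + Chat i * norm (df i (x k \<omega>))) \<le> \<alpha> k * (C i + M_F * B)"
        using pos[OF k] by (intro mult_left_mono) auto
      then show ?case
        using elim(1,2) by auto
    qed
    show "integrable M (\<lambda>\<omega>. norm (g i (x k \<omega>) (w k \<omega>) - df i (x k \<omega>)))"
      "(\<integral>\<omega>. norm (g i (x k \<omega>) (w k \<omega>) - df i (x k \<omega>)) \<partial>M) \<le> \<alpha> k * (C i + M_F * B)"
      using moment[OF k, of "\<lambda>y \<xi>. norm (g i y \<xi> - df i y)", OF _ _ bound]
      by simp_all
  qed

  have sec: "integrable M (\<lambda>\<omega>. (norm (g i (x k \<omega>) (w k \<omega>)))\<^sup>2)"
      "(\<integral>\<omega>. (norm (g i (x k \<omega>) (w k \<omega>)))\<^sup>2 \<partial>M) \<le> (Gs i)\<^sup>2 + G_V\<^sup>2 / m * B\<^sup>2"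
    if k: "k \<ge> 1" for k i
  proof -
    have bound: "AE \<omega> in M. integrable D (\<lambda>\<xi>. (norm (g i (x k \<omega>) \<xi>))\<^sup>2) \<and>
        (\<integral>\<xi>. (norm (g i (x k \<omega>) \<xi>))\<^sup>2 \<partial>D) \<le> (Gs i)\<^sup>2 + G_V\<^sup>2 / m * B\<^sup>2"
      using Gs(3)[OF k, of i] unbiased[OF k, of i] AE_space
    proof eventually_elim
      case (elim \<omega>)
      \<comment> \<open>The second moment is the variance plus the squared norm of the mean; by
        unbiasedness the mean is the true gradient, hence the \<open>+ 1\<close>.\<close>
      have "(\<integral>\<xi>. (norm (g i (x k \<omega>) \<xi>))\<^sup>2 \<partial>D)
          \<le> (Gs i)\<^sup>2 + ((Ghat i)\<^sup>2 + 1) * (norm (df i (x k \<omega>)))\<^sup>2"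
        using elim by (simp add: vec_variance_def algebra_simps)
      also have "\<dots> \<le> (Gs i)\<^sup>2 + G_V\<^sup>2 / m * B\<^sup>2"
        using Ghat_le[of i] sq_le[OF xX[OF k elim(3)]] m1
          order_trans[OF add_nonneg_nonneg[OF zero_le_power2 zero_le_one] Ghat_le[of i]]
        by (intro add_left_mono mult_mono) (simp_all add: G_V m_def)
      finally show ?case using elim by simp
    qed
    show "integrable M (\<lambda>\<omega>. (norm (g i (x k \<omega>) (w k \<omega>)))\<^sup>2)"
      "(\<integral>\<omega>. (norm (g i (x k \<omega>) (w k \<omega>)))\<^sup>2 \<partial>M) \<le> (Gs i)\<^sup>2 + G_V\<^sup>2 / m * B\<^sup>2"
      using moment[OF k, of "\<lambda>y \<xi>. (norm (g i y \<xi>))\<^sup>2", OF _ _ bound]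
      by simp_all
  qed

  have sum_err: "(\<Sum>i\<in>UNIV. \<alpha> k * (C i + M_F * B)) = \<alpha> k * L_nablaS" for k
    unfolding L_nablaS M1 B_def[symmetric]
    by (simp add: sum_distrib_left[symmetric] sum.distrib mult.assoc)
  \<comment> \<open>The extra factors \<open>m\<close> in \<open>L_g\<close> are absorbed using
    \<open>m \<ge> 1\<close>.\<close>
  have sum_sec: "(\<Sum>i\<in>UNIV. (Gs i)\<^sup>2 + G_V\<^sup>2 / m * B\<^sup>2) \<le> L_g\<^sup>2"
  proof -
    have "(\<Sum>i\<in>UNIV. (Gs i)\<^sup>2 + G_V\<^sup>2 / m * B\<^sup>2) = 1 * (\<Sum>i\<in>UNIV. (Gs i)\<^sup>2) + 1 * (G_V\<^sup>2 * B\<^sup>2)"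
      using m1 by (simp add: sum.distrib m_def)
    also have "\<dots> \<le> m * (\<Sum>i\<in>UNIV. (Gs i)\<^sup>2) + m * (G_V\<^sup>2 * B\<^sup>2)"
      using m1 by (intro add_mono mult_right_mono sum_nonneg) auto
    also have "\<dots> = L_g\<^sup>2"
      by (simp add: L_g G B_def m_def)
    finally show ?thesis .
  qed
  have M_F0: "0 \<le> M_F" using C(2) Chat_le by (meson less_imp_le order_trans)
  have L_nablaS0: "0 \<le> L_nablaS"
    using C(1) M_F0 B0 unfolding L_nablaS M1 B_def[symmetric]
    by (intro add_nonneg_nonneg sum_nonneg mult_nonneg_nonneg) (auto intro: less_imp_le)
  \<comment> \<open>The dimension is at least 1, so the factor \<open>sqrt (real CARD('n))\<close>
    only enlarges \<open>M_S\<close>.\<close>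
  have M_S_ge: "sqrt m * B \<le> M_S"
  proof -
    have "sqrt m * 1 \<le> sqrt m * sqrt (real CARD('n))"
      using m1 by (intro mult_left_mono) (auto simp: Suc_le_eq)
    then show ?thesis
      unfolding M_S B_def[symmetric] m_def[symmetric] real_sqrt_mult
      using B0 by (intro mult_right_mono) auto
  qed
  have M_S0: "0 \<le> M_S"
    using M_S_ge B0 m1 by (meson mult_nonneg_nonneg order_trans real_sqrt_ge_zero zero_le_one)

  \<comment> \<open>Expected decrease and summation\<close>
  \<comment> \<open>\<open>c\<close> is the coefficient of \<open>(\<alpha> k)\<^sup>2\<close>: the
    gradient error is itself of order \<open>\<alpha> k\<close> and enters multiplied by
    \<open>2 * \<alpha> k\<close>.\<close>
  define c where "c = L_g\<^sup>2 + 2 * \<Theta> * (L_nablaS + \<beta> * L_nablaS * M_S)"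
  have c0: "0 \<le> c"
    using L_nablaS0 M_S0 \<Theta>(2) \<Lambda>(2) by (auto simp: c_def intro!: add_nonneg_nonneg mult_nonneg_nonneg)
  \<comment> \<open>\<open>a\<close> and \<open>e\<close> are the sequences for the scalar
    recursion, with \<open>T\<close> equal to \<open>\<Theta>\<^sup>2\<close>. In \<open>e\<close>
    the value at \<open>xstar\<close> is taken at the still random weights
    \<open>lam k\<close>.\<close>
  define a where "a k = (\<integral>\<omega>. (norm (x k \<omega> - xstar))\<^sup>2 \<partial>M)" for k
  define e where "e k = (\<integral>\<omega>. weighted_sum f (x k \<omega>) (lam k \<omega>) \<partial>M)
    - (\<integral>\<omega>. weighted_sum f xstar (lam k \<omega>) \<partial>M)" for k

  have "compact X" using X(2) \<Theta>(1) by (simp add: compact_eq_bounded_closed)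
  have int_S: "integrable M (\<lambda>\<omega>. weighted_sum f (x k \<omega>) (lam k \<omega>))"
      "integrable M (\<lambda>\<omega>. weighted_sum f xstar (lam k \<omega>))" if k: "k \<ge> 1" for k
    using x_meas[OF k] lam_meas[OF k] xX[OF k] simplex(2)[OF k] xstar
    by (auto intro!: M.integrable_weighted_sum[OF \<open>compact X\<close> f_cont])
  have dist_le: "(norm (x k \<omega> - xstar))\<^sup>2 \<le> \<Theta>\<^sup>2" if "k \<ge> 1" "\<omega> \<in> space M" for k \<omega>
    using \<Theta>(3)[OF xX[OF that] xstar] by (intro power_mono) auto
  have int_d: "integrable M (\<lambda>\<omega>. (norm (x k \<omega> - xstar))\<^sup>2)" if k: "k \<ge> 1" for k
  proof -
    note [measurable] = x_meas[OF k]
    show ?thesis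
      using dist_le[OF k] by (intro M.integrable_const_bound[of _ "\<Theta>\<^sup>2"] AE_I2) auto
  qed
  have a: "0 \<le> a k" "a k \<le> \<Theta>\<^sup>2" if k: "k \<ge> 1" for k
    using M.integral_le_const[OF int_d[OF k], of "\<Theta>\<^sup>2"] dist_le[OF k]
    by (auto simp: a_def)

  have decrease: "a (Suc k) + 2 * \<alpha> k * e k \<le> a k + (\<alpha> k)\<^sup>2 * c" if k: "k \<ge> 1" for k
  proof -
    define K where "K = 1 + \<beta> * (sqrt m * B)"
    have K: "0 \<le> K" "K \<le> 1 + \<beta> * M_S"
      using B0 m1 M_S_ge \<Lambda>(2) by (auto simp: K_def)
    have Suc: "Suc k \<ge> 1" by simp
    have pointwise: "(norm (x (Suc k) \<omega> - xstar))\<^sup>2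
        + 2 * \<alpha> k * (weighted_sum f (x k \<omega>) (lam k \<omega>) - weighted_sum f xstar (lam k \<omega>))
        \<le> (norm (x k \<omega> - xstar))\<^sup>2 + (\<alpha> k)\<^sup>2 * (\<Sum>i\<in>UNIV. (norm (g i (x k \<omega>) (w k \<omega>)))\<^sup>2)
          + 2 * \<alpha> k * \<Theta> * K * (\<Sum>i\<in>UNIV. norm (g i (x k \<omega>) (w k \<omega>) - df i (x k \<omega>)))"
      if \<omega>: "\<omega> \<in> space M" for \<omega>
    proof -
      have "norm (lg k \<omega> - lam k \<omega>) \<le> \<beta> * norm (tup (x k \<omega>) (w k \<omega>) - grad (x k \<omega>))"
        using lipschitz_onD[OF \<Lambda>(3)] inA[OF k \<omega>]
        by (simp add: A_def lg_eq[OF k \<omega>] lam_eq[OF k \<omega>] dist_norm)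
      then show ?thesis
        using projected_step_le[of X xstar "lam k \<omega>" "lg k \<omega>" "\<alpha> k" \<beta> "x k \<omega>" \<Theta>
            "tup (x k \<omega>) (w k \<omega>)" "grad (x k \<omega>)" B f]
          X xstar simplex[OF k \<omega>] pos[OF k] \<Lambda>(2) \<Theta>(3)[OF xX[OF k \<omega>] xstar]
          df_le[OF xX[OF k \<omega>]] convex_on_above_gradient[OF convex(1) gradient(1)]
        by (simp add: run_rec[OF k \<omega>] tup_def grad_def K_def m_def)
    qed
    have "a (Suc k) + 2 * \<alpha> k * e k
        = (\<integral>\<omega>. (norm (x (Suc k) \<omega> - xstar))\<^sup>2
        + 2 * \<alpha> k * (weighted_sum f (x k \<omega>) (lam k \<omega>) - weighted_sum f xstar (lam k \<omega>)) \<partial>M)"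
      using int_d[OF Suc] int_S[OF k] by (simp add: a_def e_def)
    also have "\<dots> \<le> (\<integral>\<omega>. (norm (x k \<omega> - xstar))\<^sup>2
          + (\<alpha> k)\<^sup>2 * (\<Sum>i\<in>UNIV. (norm (g i (x k \<omega>) (w k \<omega>)))\<^sup>2)
          + 2 * \<alpha> k * \<Theta> * K * (\<Sum>i\<in>UNIV. norm (g i (x k \<omega>) (w k \<omega>) - df i (x k \<omega>))) \<partial>M)"
      using int_d[OF Suc] int_d[OF k] int_S[OF k] err(1)[OF k] sec(1)[OF k]
      by (intro integral_mono pointwise) auto
    also have "\<dots> = a k + (\<alpha> k)\<^sup>2 * (\<Sum>i\<in>UNIV. \<integral>\<omega>. (norm (g i (x k \<omega>) (w k \<omega>)))\<^sup>2 \<partial>M)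
          + 2 * \<alpha> k * \<Theta> * K * (\<Sum>i\<in>UNIV. \<integral>\<omega>. norm (g i (x k \<omega>) (w k \<omega>) - df i (x k \<omega>)) \<partial>M)"
      using int_d[OF k] err(1)[OF k] sec(1)[OF k] by (simp add: a_def)
    \<comment> \<open>Here the moment bounds enter; summed over \<open>i\<close>, the first-order
      errors give \<open>\<alpha> k * L_nablaS\<close>.\<close>
    also have "\<dots> \<le> a k + (\<alpha> k)\<^sup>2 * L_g\<^sup>2 + 2 * \<alpha> k * \<Theta> * K * (\<alpha> k * L_nablaS)"
      using pos[OF k] \<Theta>(2) K(1) sec(2)[OF k] err(2)[OF k] unfolding sum_err[symmetric]
      by (intro add_mono mult_left_mono order_trans[OF sum_mono sum_sec] sum_mono
          mult_nonneg_nonneg) auto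
    also have "\<dots> \<le> a k + (\<alpha> k)\<^sup>2 * L_g\<^sup>2 + 2 * \<alpha> k * \<Theta> * (1 + \<beta> * M_S) * (\<alpha> k * L_nablaS)"
      using pos[OF k] \<Theta>(2) K L_nablaS0
      by (intro add_left_mono mult_left_mono mult_right_mono mult_nonneg_nonneg) auto
    also have "\<dots> = a k + (\<alpha> k)\<^sup>2 * c"
      by (simp add: c_def power2_eq_square algebra_simps)
    finally show ?thesis .
  qed

  have sum_e: "(\<Sum>s=1..k. e s) \<le> (\<Theta>\<^sup>2 / (2 * \<alpha>bar) + \<alpha>bar * c) * sqrt k" for k
    by (rule sum_le_sqrt_of_decrease[of _ _ a]) (use \<alpha>bar_pos c0 a decrease \<alpha> in auto)

  show ?thesis
  proof (intro allI impI conjI ballI)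
    fix k :: nat and \<omega> assume "k \<ge> 1" "\<omega> \<in> space M"
    then show "lambar k \<omega> \<in> prob_simplex"
      using prob_simplex_average[of "{1..k}" "\<lambda>s. lam s \<omega>"] simplex(2) by (simp add: lambar)
  next
    fix k :: nat assume k: "k \<ge> 1"
    define s where "s = sqrt (real k)"
    have s: "s > 0" "real k = s * s" using k by (auto simp: s_def)
    \<comment> \<open>Both terms are now compared with averages over \<open>s\<close>: the one at
      \<open>xstar\<close> equals its average, and the minimum lies below its own.\<close>
    have "(\<integral>\<omega>. weighted_sum f xstar (lambar k \<omega>) \<partial>M)
        = (\<Sum>s=1..k. \<integral>\<omega>. weighted_sum f xstar (lam s \<omega>) \<partial>M) / k"
      using int_S(2) by (simp add: lambar weighted_sum_average)
    moreover have "(MIN s\<in>{1..k}. \<integral>\<omega>. weighted_sum f (x s \<omega>) (lam s \<omega>) \<partial>M)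
        \<le> (\<Sum>s=1..k. \<integral>\<omega>. weighted_sum f (x s \<omega>) (lam s \<omega>) \<partial>M) / k"
      using Min_le_average[of "{1..k}"] k by simp
    ultimately have "(MIN s\<in>{1..k}. \<integral>\<omega>. weighted_sum f (x s \<omega>) (lam s \<omega>) \<partial>M)
        - (\<integral>\<omega>. weighted_sum f xstar (lambar k \<omega>) \<partial>M) \<le> (\<Sum>s=1..k. e s) / k"
      by (simp add: e_def sum_subtractf diff_divide_distrib)
    also have "\<dots> \<le> (\<Theta>\<^sup>2 / (2 * \<alpha>bar) + \<alpha>bar * c) * sqrt k / k"
      using sum_e[of k] by (intro divide_right_mono) auto
    also have "\<dots> = (\<Theta>\<^sup>2 / (2 * \<alpha>bar) + \<alpha>bar * c) / sqrt k"
      using s unfolding s_def[symmetric] by simp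
    finally show "(MIN s\<in>{1..k}. \<integral>\<omega>. weighted_sum f (x s \<omega>) (lam s \<omega>) \<partial>M)
        - (\<integral>\<omega>. weighted_sum f xstar (lambar k \<omega>) \<partial>M)
      \<le> (\<Theta>\<^sup>2 / (2 * \<alpha>bar)
          + \<alpha>bar * (L_g\<^sup>2 + 2 * \<Theta> * (L_nablaS + \<beta> * L_nablaS * M_S))) / sqrt (real k)"
      by (simp add: c_def)
  qed
qed

end
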